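(* Let $N\ge3$ be an integer and $p\ge q>0$ with $pq>1$. Let $(u_1,u_2)$ be any radial solution of the system $-\Delta u_1=|\nabla u_2|^p$, $-\Delta u_2=|\nabla u_1|^q$, and let $w_1=-r^{N-1}u_1'$, $w_2=-r^{N-1}u_2'$. Then, at the points where $u_1'\neq 0$ and $u_2'\ne0$, the function $w=|w_1|$ satisfies the equation $$-(|w'|^{\mathbf p-2}w')'-\frac{\mathbf N-1}{r}|w'|^{\mathbf p-2}w'=\varepsilon r^{\sigma}w^{\mathbf q},\qquad \varepsilon=-\mathrm{sign}(u_1'u_2'),$$ with $$\mathbf p=1+\frac1p>1,\qquad \mathbf q=q,\qquad \sigma=(N-1)\frac{1-pq}{p},\qquad \mathbf N=1+\frac{(N-1)(p-1)}{p}.$$ Moreover, at each such point, the quantities $$S=r\frac{|u_2'|^p}{u_1'},\quad Z=-r\frac{|u_1'|^q}{u_2'},\qquad s=-r\frac{w'}{w},\quad z=-\varepsilon r^{1+\sigma}w^{\mathbf q}|w'|^{-\mathbf p}w'$$ satisfy $$S=s=-r\frac{w_1'}{w_1},\qquad Z=z=r\frac{w_2'}{w_2}=-\mathrm{sign}(u_2')\,r^{1+\sigma}|w_1|^{q}|w_1'|^{-\mathbf p}w_1' .$$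
   Context: Here $r=|x|$, $'=d/dr$; radial solutions are $C^2$ functions of $r$ on an interval of $(0,\infty)$ satisfying $-(u_1''+\frac{N-1}ru_1')=|u_2'|^p$, $-(u_2''+\frac{N-1}ru_2')=|u_1'|^q$, with no condition of sign. The left-hand side of the equation for $w$ is $-\Delta^{\mathbf N}_{\mathbf p}w$, minus the radial $\mathbf p$-Laplace operator in (not necessarily integer) dimension $\mathbf N$. *)

theory Defs
  imports "HOL-Analysis.Analysis"
begin

text \<open>The interval may contain its endpoints, so derivatives are taken relative to it;
  at interior points this is the ordinary derivative.\<close>

abbreviation deriv_in :: "real set \<Rightarrow> (real \<Rightarrow> real) \<Rightarrow> real \<Rightarrow> real" where
  "deriv_in I f \<equiv> (\<lambda>r. vector_derivative f (at r within I))"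

definition C2_on :: "real set \<Rightarrow> (real \<Rightarrow> real) \<Rightarrow> bool" where
  "C2_on I f \<longleftrightarrow> f differentiable_on I \<and> deriv_in I f differentiable_on I
     \<and> continuous_on I (deriv_in I (deriv_in I f))"

definition radial_laplacian :: "nat \<Rightarrow> real set \<Rightarrow> (real \<Rightarrow> real) \<Rightarrow> real \<Rightarrow> real" where
  "radial_laplacian N I u r = deriv_in I (deriv_in I u) r + (real N - 1) / r * deriv_in I u r"

text \<open>Degenerate intervals are excluded: the relative derivative is not unique there.\<close>

definition radial_solution ::
  "nat \<Rightarrow> real \<Rightarrow> real \<Rightarrow> real set \<Rightarrow> (real \<Rightarrow> real) \<Rightarrow> (real \<Rightarrow> real) \<Rightarrow> bool" where
  "radial_solution N p q I u\<^sub>1 u\<^sub>2 \<longleftrightarrow>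
     is_interval I \<and> interior I \<noteq> {} \<and> I \<subseteq> {0<..} \<and>
     C2_on I u\<^sub>1 \<and> C2_on I u\<^sub>2 \<and>
     (\<forall>r\<in>I. - radial_laplacian N I u\<^sub>1 r = \<bar>deriv_in I u\<^sub>2 r\<bar> powr p) \<and>
     (\<forall>r\<in>I. - radial_laplacian N I u\<^sub>2 r = \<bar>deriv_in I u\<^sub>1 r\<bar> powr q)"

definition flux :: "real \<Rightarrow> real set \<Rightarrow> (real \<Rightarrow> real) \<Rightarrow> real \<Rightarrow> real" where
  "flux P I w r = \<bar>deriv_in I w r\<bar> powr (P - 2) * deriv_in I w r"

definition radial_p_laplacian ::
  "real \<Rightarrow> real \<Rightarrow> real set \<Rightarrow> (real \<Rightarrow> real) \<Rightarrow> real \<Rightarrow> real" where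
  "radial_p_laplacian P M I w r = deriv_in I (flux P I w) r + (M - 1) / r * flux P I w r"

text \<open>Since \<open>vector_derivative\<close> is total, differentiability of both \<open>w\<close> and its flux is part of
  what it means to satisfy the equation at a point.\<close>

definition satisfies_p_laplace_at ::
  "real \<Rightarrow> real \<Rightarrow> real set \<Rightarrow> (real \<Rightarrow> real) \<Rightarrow> real \<Rightarrow> real \<Rightarrow> bool" where
  "satisfies_p_laplace_at P M I w r rhs \<longleftrightarrow>
     (\<forall>\<^sub>F t in at r within I. w differentiable (at t within I)) \<and>
     w differentiable (at r within I) \<and>
     flux P I w differentiable (at r within I) \<and>
     - radial_p_laplacian P M I w r = rhs"

end

theory Submission
  imports Defs
begin

text \<open>
  Put \<open>n = N - 1\<close>. Multiplying each equation of the system by \<open>r\<^sup>n\<close> turns its left-hand side into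
  an exact derivative, so that the momenta \<open>w\<^sub>1\<close>, \<open>w\<^sub>2\<close> solve the first-order system
  \<open>w\<^sub>1' = r\<^bsup>n(1-p)\<^esup>|w\<^sub>2|\<^sup>p\<close>, \<open>w\<^sub>2' = r\<^bsup>n(1-q)\<^esup>|w\<^sub>1|\<^sup>q\<close>
  (\<open>momentum_derivative\<close>, \<open>power_weight\<close>).

  The exponent \<open>\<^bold>p = 1 + 1/p\<close> is the one for which the flux inverts the first equation:
  \<open>|y|\<^bsup>\<^bold>p-2\<^esup>y = sgn y |y|\<^bsup>1/p\<^esup>\<close>, so the \<open>p\<close>-th root of \<open>|w\<^sub>1'|\<close> gives \<open>|w\<^sub>2|\<close> back, times a power
  of \<open>r\<close>. As long as \<open>w\<^sub>1\<close> and \<open>w\<^sub>2\<close> keep their signs, the flux of \<open>w = |w\<^sub>1|\<close> is therefore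
  a constant sign times \<open>r\<^bsup>1-\<^bold>N\<^esup>w\<^sub>2\<close> (\<open>flux_abs_eq\<close>). The dimension \<open>\<^bold>N\<close> is chosen so that the
  derivative of the power of \<open>r\<close> is cancelled by the term \<open>(\<^bold>N - 1)/r\<close> of the radial
  \<open>\<^bold>p\<close>-Laplacian; only \<open>w\<^sub>2'\<close>, known from the second equation, survives
  (\<open>abs_satisfies_p_laplace\<close>). The same inversion of the first equation expresses the logarithmic
  derivative of \<open>w\<^sub>2\<close> by \<open>w\<^sub>1\<close> and \<open>w\<^sub>1'\<close> alone (\<open>log_derivative_eq\<close>), which gives \<open>Z = z\<close>; the
  identity \<open>S = s\<close> is immediate because the logarithmic derivative ignores signs.
\<close>

lemma at_within_interval_neq_bot:
  fixes I :: "real set"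
  assumes "is_interval I" "interior I \<noteq> {}" "r \<in> I"
  shows "at r within I \<noteq> bot"
proof -
  have "I \<noteq> {x}" for x
    using assms(2) by (metis interior_singleton)
  then show ?thesis
    using connected_imp_perfect[of I r] assms is_interval_connected
    by (auto simp: trivial_limit_within)
qed

lemma deriv_in_eq:
  assumes "at r within I \<noteq> bot" "(f has_real_derivative y) (at r within I)"
  shows "deriv_in I f r = y"
  using assms by (simp add: has_real_derivative_iff_has_vector_derivative vector_derivative_within)

lemma differentiable_has_deriv_in:
  assumes "f differentiable (at r within I)"
  shows "(f has_real_derivative deriv_in I f r) (at r within I)"
  using assms
  by (simp add: has_real_derivative_iff_has_vector_derivative vector_derivative_works)

lemma eventually_sgn_const:
  fixes f :: "real \<Rightarrow> real"
  assumes "continuous (at r within I) f" "f r \<noteq> 0"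
  shows "\<forall>\<^sub>F t in at r within I. sgn (f t) = sgn (f r)"
proof -
  have lim: "(f \<longlongrightarrow> f r) (at r within I)"
    using assms(1) by (simp add: continuous_within)
  show ?thesis
  proof (cases "f r > 0")
    case True
    from order_tendstoD(1)[OF lim True] show ?thesis
      by eventually_elim (use True in simp)
  next
    case False
    with assms(2) have neg: "f r < 0" by simp
    from order_tendstoD(2)[OF lim neg] show ?thesis
      by eventually_elim (use neg in simp)
  qed
qed

lemma has_real_derivative_abs_within:
  fixes f :: "real \<Rightarrow> real"
  assumes d: "(f has_real_derivative y) (at r within I)" and nz: "f r \<noteq> 0"
  shows "((\<lambda>t. \<bar>f t\<bar>) has_real_derivative sgn (f r) * y) (at r within I)"
proof -
  have "\<forall>\<^sub>F t in at r within I. sgn (f r) * f t = \<bar>f t\<bar>"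
    using eventually_sgn_const[OF DERIV_continuous[OF d] nz]
    by eventually_elim (metis abs_sgn mult.commute)
  moreover have "sgn (f r) * f r = \<bar>f r\<bar>"
    by (simp add: abs_sgn mult.commute)
  ultimately show ?thesis
    using has_field_derivative_cong_eventually[of "\<lambda>t. sgn (f r) * f t" "\<lambda>t. \<bar>f t\<bar>" r I]
      DERIV_cmult[OF d] by blast
qed

text \<open>The factor \<open>r\<^bsup>N-1\<^esup>\<close> integrates the radial Laplacian: \<open>r\<^bsup>N-1\<^esup>\<Delta>u = (r\<^bsup>N-1\<^esup>u')'\<close>.\<close>

lemma momentum_derivative:
  assumes "N \<ge> 1" "r > 0" and du: "deriv_in I u differentiable (at r within I)"
  shows "((\<lambda>t. - (t ^ (N - 1) * deriv_in I u t)) has_real_derivative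
           r ^ (N - 1) * (- radial_laplacian N I u r)) (at r within I)"
proof -
  have "(deriv_in I u has_real_derivative deriv_in I (deriv_in I u) r) (at r within I)"
    by (rule differentiable_has_deriv_in[OF du])
  note d = DERIV_minus[OF DERIV_mult[OF DERIV_pow[of "N - 1"] this]]
  have "real (N - 1) * r ^ (N - 1 - Suc 0) = r ^ (N - 1) * ((real N - 1) / r)"
  proof (cases "N - 1")
    case 0
    then show ?thesis using assms(1) by simp
  next
    case (Suc k)
    then have "real N - 1 = real (Suc k)" using assms(1) by simp
    then show ?thesis using Suc assms(2) by (simp add: field_simps)
  qed
  then show ?thesis
    by (intro DERIV_cong[OF d]) (simp add: radial_laplacian_def algebra_simps)
qed

text \<open>Rewrites the weighted right-hand sides in the momentum \<open>r\<^sup>k v\<close> in place of \<open>v\<close>.\<close>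

lemma power_weight:
  fixes r v p :: real
  assumes "r > 0"
  shows "r ^ k * \<bar>v\<bar> powr p = r powr (real k * (1 - p)) * \<bar>- (r ^ k * v)\<bar> powr p"
proof -
  have "\<bar>- (r ^ k * v)\<bar> powr p = r powr (real k * p) * \<bar>v\<bar> powr p"
    using assms by (simp add: abs_mult powr_mult powr_powr flip: powr_realpow)
  moreover have "r powr (real k * (1 - p)) * r powr (real k * p) = r ^ k"
    using assms by (simp add: algebra_simps flip: powr_add powr_realpow)
  ultimately show ?thesis by (metis mult.assoc)
qed

lemma powr_root_weight:
  fixes r y p n :: real
  assumes "r > 0" "p > 0"
  shows "(r powr (n * (1 - p)) * \<bar>y\<bar> powr p) powr (1 / p) = r powr (- (n * (p - 1) / p)) * \<bar>y\<bar>"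
proof -
  have "n * (1 - p) / p = - (n * (p - 1) / p)"
    using assms by (simp add: field_simps)
  then show ?thesis using assms by (simp add: powr_mult powr_powr)
qed

text \<open>
  The first equation of the first-order system, solved for \<open>w\<^sub>2\<close>: this identifies the flux of
  \<open>|w\<^sub>1|\<close> with exponent \<open>1 + 1/p\<close>.
\<close>

lemma flux_abs_eq:
  fixes w\<^sub>1 w\<^sub>2 :: "real \<Rightarrow> real" and n p :: real
  assumes "at t within I \<noteq> bot" "t > 0" "p > 0"
    and d: "(w\<^sub>1 has_real_derivative t powr (n * (1 - p)) * \<bar>w\<^sub>2 t\<bar> powr p) (at t within I)"
    and nz: "w\<^sub>1 t \<noteq> 0"
  shows "flux (1 + 1 / p) I (\<lambda>r. \<bar>w\<^sub>1 r\<bar>) t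
           = sgn (w\<^sub>1 t) * sgn (w\<^sub>2 t) * (t powr (- (n * (p - 1) / p)) * w\<^sub>2 t)"
proof -
  define y where "y = t powr (n * (1 - p)) * \<bar>w\<^sub>2 t\<bar> powr p"
  have "y \<ge> 0" by (simp add: y_def)
  have D: "deriv_in I (\<lambda>r. \<bar>w\<^sub>1 r\<bar>) t = sgn (w\<^sub>1 t) * y"
    using deriv_in_eq[OF assms(1) has_real_derivative_abs_within[OF d nz]] by (simp add: y_def)
  have abs: "\<bar>sgn (w\<^sub>1 t) * y\<bar> = y"
    using nz \<open>y \<ge> 0\<close> by (simp add: abs_mult abs_sgn_eq)
  have "y powr (1 / p - 1) * y = y powr (1 / p)"
    using \<open>y \<ge> 0\<close> by (cases "y = 0") (simp_all add: powr_diff)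
  then have "flux (1 + 1 / p) I (\<lambda>r. \<bar>w\<^sub>1 r\<bar>) t = sgn (w\<^sub>1 t) * y powr (1 / p)"
    unfolding flux_def D abs by (simp add: mult.left_commute)
  also have "y powr (1 / p) = t powr (- (n * (p - 1) / p)) * \<bar>w\<^sub>2 t\<bar>"
    unfolding y_def using assms by (intro powr_root_weight)
  also have "\<bar>w\<^sub>2 t\<bar> = sgn (w\<^sub>2 t) * w\<^sub>2 t"
    by (simp add: abs_sgn mult.commute)
  finally show ?thesis by (simp add: mult_ac)
qed

text \<open>
  By continuity the signs of \<open>w\<^sub>1\<close> and \<open>w\<^sub>2\<close> are constant near \<open>r\<close>, so the formula of the
  preceding lemma can be differentiated there. The exponents of \<open>r\<close> add up because
  \<open>- n(p-1)/p + n(1-q) = n(1-pq)/p\<close>.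
\<close>

lemma abs_satisfies_p_laplace:
  fixes w\<^sub>1 w\<^sub>2 :: "real \<Rightarrow> real" and n p q :: real
  assumes I: "\<And>t. t \<in> I \<Longrightarrow> at t within I \<noteq> bot" "I \<subseteq> {0<..}" and "p > 0"
    and d1: "\<And>t. t \<in> I \<Longrightarrow>
      (w\<^sub>1 has_real_derivative t powr (n * (1 - p)) * \<bar>w\<^sub>2 t\<bar> powr p) (at t within I)"
    and d2: "(w\<^sub>2 has_real_derivative r powr (n * (1 - q)) * \<bar>w\<^sub>1 r\<bar> powr q) (at r within I)"
    and r: "r \<in> I" "w\<^sub>1 r \<noteq> 0" "w\<^sub>2 r \<noteq> 0"
  shows "satisfies_p_laplace_at (1 + 1 / p) (1 + n * (p - 1) / p) I (\<lambda>t. \<bar>w\<^sub>1 t\<bar>) r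
           (- sgn (w\<^sub>1 r * w\<^sub>2 r) * r powr (n * ((1 - p * q) / p)) * \<bar>w\<^sub>1 r\<bar> powr q)"
proof -
  let ?w = "\<lambda>t. \<bar>w\<^sub>1 t\<bar>"
  define a where "a = n * (p - 1) / p"
  define c where "c = sgn (w\<^sub>1 r) * sgn (w\<^sub>2 r)"
  define F where "F = flux (1 + 1 / p) I ?w"
  have "r > 0" using I(2) r(1) by auto
  have sgn1: "\<forall>\<^sub>F t in at r within I. sgn (w\<^sub>1 t) = sgn (w\<^sub>1 r)"
    by (rule eventually_sgn_const[OF DERIV_continuous[OF d1[OF r(1)]] r(2)])
  have sgn2: "\<forall>\<^sub>F t in at r within I. sgn (w\<^sub>2 t) = sgn (w\<^sub>2 r)"
    by (rule eventually_sgn_const[OF DERIV_continuous[OF d2] r(3)])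
  have ev_I: "\<forall>\<^sub>F t in at r within I. t \<in> I"
    by (simp add: eventually_at_filter)
  have dw: "?w differentiable (at t within I)" if "t \<in> I" "w\<^sub>1 t \<noteq> 0" for t
    using has_real_derivative_abs_within[OF d1[OF that(1)] that(2)]
    by (auto simp: real_differentiable_def)
  have F_formula: "F t = sgn (w\<^sub>1 t) * sgn (w\<^sub>2 t) * (t powr (- a) * w\<^sub>2 t)"
    if "t \<in> I" "w\<^sub>1 t \<noteq> 0" for t
    unfolding F_def a_def using that I(2) \<open>p > 0\<close>
    by (intro flux_abs_eq[OF I(1) _ _ d1]) auto
  have ev_dw: "\<forall>\<^sub>F t in at r within I. ?w differentiable (at t within I)"
    using ev_I sgn1 by eventually_elim (use r(2) dw in \<open>metis sgn_zero_iff\<close>)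
  have ev_F: "\<forall>\<^sub>F t in at r within I. c * (t powr (- a) * w\<^sub>2 t) = F t"
    using ev_I sgn1 sgn2
  proof eventually_elim
    case (elim t)
    then have "w\<^sub>1 t \<noteq> 0" using r(2) by (metis sgn_zero_iff)
    with elim show ?case by (simp add: F_formula c_def)
  qed
  let ?w2' = "r powr (n * (1 - q)) * \<bar>w\<^sub>1 r\<bar> powr q"
  let ?F' = "c * (r powr (- a) * ?w2' - a / r * (r powr (- a) * w\<^sub>2 r))"
  have dpow: "((\<lambda>t. t powr (- a)) has_real_derivative - a * r powr (- a - 1)) (at r within I)"
    using has_real_derivative_powr[OF \<open>r > 0\<close>] by (rule has_field_derivative_at_within)
  have "((\<lambda>t. c * (t powr (- a) * w\<^sub>2 t)) has_real_derivative ?F') (at r within I)"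
    using \<open>r > 0\<close>
    by (intro DERIV_cong[OF DERIV_cmult[OF DERIV_mult[OF dpow d2]]])
       (simp add: powr_diff field_simps)
  then have dF: "(F has_real_derivative ?F') (at r within I)"
    using has_field_derivative_cong_eventually[OF ev_F] F_formula[OF r(1,2)]
    by (simp add: c_def)
  have exponent: "- a + n * (1 - q) = n * ((1 - p * q) / p)"
    using \<open>p > 0\<close> by (simp add: a_def field_simps)
  have "radial_p_laplacian (1 + 1 / p) (1 + a) I ?w r = ?F' + a / r * F r"
    using deriv_in_eq[OF I(1)[OF r(1)] dF] by (simp add: radial_p_laplacian_def F_def)
  also have "\<dots> = c * (r powr (- a) * ?w2')"
    using F_formula[OF r(1,2)] by (simp add: c_def algebra_simps)
  also have "\<dots> = sgn (w\<^sub>1 r * w\<^sub>2 r) * r powr (n * ((1 - p * q) / p)) * \<bar>w\<^sub>1 r\<bar> powr q"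
    unfolding exponent[symmetric] powr_add by (simp add: c_def sgn_mult)
  finally have "- radial_p_laplacian (1 + 1 / p) (1 + n * (p - 1) / p) I ?w r
      = - sgn (w\<^sub>1 r * w\<^sub>2 r) * r powr (n * ((1 - p * q) / p)) * \<bar>w\<^sub>1 r\<bar> powr q"
    by (simp add: a_def)
  moreover have "F differentiable (at r within I)"
    using dF by (auto simp: real_differentiable_def)
  ultimately show ?thesis
    using ev_dw dw[OF r(1,2)] unfolding satisfies_p_laplace_at_def F_def by blast
qed

text \<open>
  With \<open>A\<close> and \<open>B\<close> the values of \<open>w\<^sub>1\<close> and \<open>w\<^sub>2\<close> at \<open>r\<close>, and \<open>y\<close> that of
  \<open>w\<^sub>1'\<close>: since \<open>y > 0\<close>, \<open>|y|\<^bsup>-\<^bold>p\<^esup>y = y\<^bsup>-1/p\<^esup>\<close> is \<open>1/|B|\<close> up to a power of \<open>r\<close>.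
\<close>

lemma log_derivative_eq:
  fixes r A B n p q :: real
  assumes "r > 0" "p > 0" "B \<noteq> 0"
    and y: "y = r powr (n * (1 - p)) * \<bar>B\<bar> powr p"
  shows "r * (r powr (n * (1 - q)) * \<bar>A\<bar> powr q / B)
    = sgn B * r powr (1 + n * ((1 - p * q) / p)) * \<bar>A\<bar> powr q * \<bar>y\<bar> powr (- (1 + 1 / p)) * y"
proof -
  define a where "a = n * (p - 1) / p"
  have "y > 0" using assms by simp
  have "y powr (1 + 1 / p) = y * y powr (1 / p)"
    using \<open>y > 0\<close> by (simp add: powr_add)
  then have "\<bar>y\<bar> powr (- (1 + 1 / p)) * y = inverse (y powr (1 / p))"
    unfolding powr_minus using \<open>y > 0\<close> by simp
  also have "\<dots> = inverse (r powr (- a) * \<bar>B\<bar>)"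
    using powr_root_weight[OF assms(1,2), of n B] by (simp add: y a_def)
  also have "\<dots> = r powr a / \<bar>B\<bar>"
    by (simp add: powr_minus field_simps)
  finally have inv: "\<bar>y\<bar> powr (- (1 + 1 / p)) * y = r powr a / \<bar>B\<bar>" .
  have "1 + n * (1 - q) = 1 + n * ((1 - p * q) / p) + a"
    using \<open>p > 0\<close> by (simp add: a_def field_simps)
  then have "r powr (1 + n * (1 - q)) = r powr (1 + n * ((1 - p * q) / p)) * r powr a"
    by (simp only: powr_add)
  moreover have "r powr (1 + n * (1 - q)) = r * r powr (n * (1 - q))"
    using \<open>r > 0\<close> by (simp add: powr_add)
  ultimately have pw: "r * r powr (n * (1 - q)) = r powr (1 + n * ((1 - p * q) / p)) * r powr a"
    by simp
  have "sgn B / \<bar>B\<bar> = 1 / B"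
    using \<open>B \<noteq> 0\<close> by (simp add: sgn_if)
  have "r * (r powr (n * (1 - q)) * \<bar>A\<bar> powr q / B)
      = (r * r powr (n * (1 - q))) * \<bar>A\<bar> powr q * (1 / B)"
    by simp
  also have "\<dots> = r powr (1 + n * ((1 - p * q) / p)) * r powr a * \<bar>A\<bar> powr q * (sgn B / \<bar>B\<bar>)"
    unfolding pw \<open>sgn B / \<bar>B\<bar> = 1 / B\<close> ..
  also have "\<dots> = sgn B * r powr (1 + n * ((1 - p * q) / p)) * \<bar>A\<bar> powr q * (r powr a / \<bar>B\<bar>)"
    by simp
  finally show ?thesis unfolding inv[symmetric] by (simp only: mult.assoc)
qed

theorem proposition3p8:
  fixes N :: nat and p q P Q \<sigma> M :: real and I :: "real set"
    and u\<^sub>1 u\<^sub>2 w\<^sub>1 w\<^sub>2 w \<epsilon> S Z s z :: "real \<Rightarrow> real"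
  assumes "N \<ge> 3" and "p \<ge> q" and "q > 0" and "p * q > 1"
    and "radial_solution N p q I u\<^sub>1 u\<^sub>2"
    and "w\<^sub>1 = (\<lambda>r. - (r ^ (N - 1) * deriv_in I u\<^sub>1 r))"
    and "w\<^sub>2 = (\<lambda>r. - (r ^ (N - 1) * deriv_in I u\<^sub>2 r))"
    and "w = (\<lambda>r. \<bar>w\<^sub>1 r\<bar>)"
    and "\<epsilon> = (\<lambda>r. - sgn (deriv_in I u\<^sub>1 r * deriv_in I u\<^sub>2 r))"
    and "P = 1 + 1 / p"
    and "Q = q"
    and "\<sigma> = (real N - 1) * ((1 - p * q) / p)"
    and "M = 1 + (real N - 1) * (p - 1) / p"
    and "S = (\<lambda>r. r * (\<bar>deriv_in I u\<^sub>2 r\<bar> powr p / deriv_in I u\<^sub>1 r))"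
    and "Z = (\<lambda>r. - (r * (\<bar>deriv_in I u\<^sub>1 r\<bar> powr q / deriv_in I u\<^sub>2 r)))"
    and "s = (\<lambda>r. - (r * (deriv_in I w r / w r)))"
    and "z = (\<lambda>r. - (\<epsilon> r * r powr (1 + \<sigma>) * w r powr Q
                       * \<bar>deriv_in I w r\<bar> powr (- P) * deriv_in I w r))"
  shows "P > 1 \<and>
    (\<forall>r\<in>I. deriv_in I u\<^sub>1 r \<noteq> 0 \<and> deriv_in I u\<^sub>2 r \<noteq> 0 \<longrightarrow>
       satisfies_p_laplace_at P M I w r (\<epsilon> r * r powr \<sigma> * w r powr Q) \<and>
       w\<^sub>1 differentiable (at r within I) \<and> w\<^sub>2 differentiable (at r within I) \<and>
       S r = s r \<and> s r = - (r * (deriv_in I w\<^sub>1 r / w\<^sub>1 r)) \<and>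
       Z r = z r \<and> z r = r * (deriv_in I w\<^sub>2 r / w\<^sub>2 r) \<and>
       r * (deriv_in I w\<^sub>2 r / w\<^sub>2 r)
         = - (sgn (deriv_in I u\<^sub>2 r) * r powr (1 + \<sigma>) * \<bar>w\<^sub>1 r\<bar> powr q
              * \<bar>deriv_in I w\<^sub>1 r\<bar> powr (- P) * deriv_in I w\<^sub>1 r))"
proof -
  define n where "n = real N - 1"
  have "p > 0" using assms(2,3) by simp
  have n: "real (N - 1) = n" using assms(1) by (simp add: n_def)
  note sol = assms(5)[unfolded radial_solution_def C2_on_def differentiable_on_def]
  have nbot: "at t within I \<noteq> bot" if "t \<in> I" for t
    using sol that by (intro at_within_interval_neq_bot) auto
  have pos: "t > 0" if "t \<in> I" for t
    using sol that by auto
  have d1: "(w\<^sub>1 has_real_derivative t ^ (N - 1) * \<bar>deriv_in I u\<^sub>2 t\<bar> powr p) (at t within I)"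
    if "t \<in> I" for t
    using momentum_derivative[of N t u\<^sub>1 I] assms(1) pos[OF that] sol that
    unfolding assms(6) by auto
  have d2: "(w\<^sub>2 has_real_derivative t ^ (N - 1) * \<bar>deriv_in I u\<^sub>1 t\<bar> powr q) (at t within I)"
    if "t \<in> I" for t
    using momentum_derivative[of N t u\<^sub>2 I] assms(1) pos[OF that] sol that
    unfolding assms(7) by auto
  have weight1: "t ^ (N - 1) * \<bar>deriv_in I u\<^sub>2 t\<bar> powr p
      = t powr (n * (1 - p)) * \<bar>w\<^sub>2 t\<bar> powr p" if "t \<in> I" for t
    using power_weight[OF pos[OF that]] by (simp only: assms(7) n)
  have weight2: "t ^ (N - 1) * \<bar>deriv_in I u\<^sub>1 t\<bar> powr q
      = t powr (n * (1 - q)) * \<bar>w\<^sub>1 t\<bar> powr q" if "t \<in> I" for t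
    using power_weight[OF pos[OF that]] by (simp only: assms(6) n)
  have sigma: "\<sigma> = n * ((1 - p * q) / p)" and M: "M = 1 + n * (p - 1) / p"
    by (simp_all only: assms(12,13) n_def)
  {
    fix r assume r: "r \<in> I" and nz: "deriv_in I u\<^sub>1 r \<noteq> 0" "deriv_in I u\<^sub>2 r \<noteq> 0"
    have "r > 0" by (rule pos[OF r])
    have w_nz: "w\<^sub>1 r \<noteq> 0" "w\<^sub>2 r \<noteq> 0"
      using nz \<open>r > 0\<close> by (simp_all add: assms(6,7))
    have sgn_w: "sgn (w\<^sub>1 r) = - sgn (deriv_in I u\<^sub>1 r)" "sgn (w\<^sub>2 r) = - sgn (deriv_in I u\<^sub>2 r)"
      using \<open>r > 0\<close> by (simp_all add: assms(6,7) sgn_mult sgn_minus)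
    have eps: "\<epsilon> r = - sgn (w\<^sub>1 r * w\<^sub>2 r)"
      by (simp add: assms(9) sgn_mult sgn_w)
    define y\<^sub>1 where "y\<^sub>1 = deriv_in I w\<^sub>1 r"
    have y1: "y\<^sub>1 = r ^ (N - 1) * \<bar>deriv_in I u\<^sub>2 r\<bar> powr p"
      unfolding y\<^sub>1_def by (rule deriv_in_eq[OF nbot[OF r] d1[OF r]])
    have y2: "deriv_in I w\<^sub>2 r = r ^ (N - 1) * \<bar>deriv_in I u\<^sub>1 r\<bar> powr q"
      by (rule deriv_in_eq[OF nbot[OF r] d2[OF r]])
    have dw: "deriv_in I w r = sgn (w\<^sub>1 r) * y\<^sub>1"
      unfolding assms(8) y1
      by (rule deriv_in_eq[OF nbot[OF r] has_real_derivative_abs_within[OF d1[OF r] w_nz(1)]])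
    have pde: "satisfies_p_laplace_at P M I w r (\<epsilon> r * r powr \<sigma> * w r powr Q)"
      unfolding assms(8,10,11) sigma M eps
    proof (rule abs_satisfies_p_laplace)
      show "(w\<^sub>1 has_real_derivative t powr (n * (1 - p)) * \<bar>w\<^sub>2 t\<bar> powr p) (at t within I)"
        if "t \<in> I" for t
        using d1[OF that] weight1[OF that] by simp
      show "(w\<^sub>2 has_real_derivative r powr (n * (1 - q)) * \<bar>w\<^sub>1 r\<bar> powr q) (at r within I)"
        using d2[OF r] weight2[OF r] by simp
    qed (use nbot pos \<open>p > 0\<close> r w_nz in auto)
    have diff: "w\<^sub>1 differentiable (at r within I)" "w\<^sub>2 differentiable (at r within I)"
      using d1[OF r] d2[OF r] by (auto simp: real_differentiable_def)
    have s_eq: "s r = - (r * (y\<^sub>1 / w\<^sub>1 r))"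
      using w_nz(1) unfolding assms(16) dw unfolding assms(8) by (simp add: sgn_if)
    have S_eq: "S r = - (r * (y\<^sub>1 / w\<^sub>1 r))"
      using \<open>r > 0\<close> by (simp add: assms(14) y1 assms(6))
    have Z_eq: "Z r = r * (deriv_in I w\<^sub>2 r / w\<^sub>2 r)"
      using \<open>r > 0\<close> unfolding assms(15) y2 unfolding assms(7) by simp
    have log: "r * (deriv_in I w\<^sub>2 r / w\<^sub>2 r)
        = - (sgn (deriv_in I u\<^sub>2 r) * r powr (1 + \<sigma>) * \<bar>w\<^sub>1 r\<bar> powr q * \<bar>y\<^sub>1\<bar> powr (- P) * y\<^sub>1)"
      using log_derivative_eq[OF \<open>r > 0\<close> \<open>p > 0\<close> w_nz(2) y1[unfolded weight1[OF r]],
          where q = q and A = "w\<^sub>1 r"]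
      unfolding y2 weight2[OF r] sigma assms(10) sgn_w by simp
    \<comment> \<open>The sign of \<open>w\<^sub>1\<close> enters \<open>z\<close> twice, through \<open>\<epsilon>\<close> and through \<open>w'\<close>, and squares to one.\<close>
    have "sgn (w\<^sub>1 r) * sgn (w\<^sub>1 r) = 1"
      using w_nz(1) by (simp add: sgn_if)
    moreover have "\<epsilon> r * sgn (w\<^sub>1 r) = sgn (w\<^sub>1 r) * sgn (w\<^sub>1 r) * sgn (deriv_in I u\<^sub>2 r)"
      by (simp add: eps sgn_mult sgn_w(2) mult_ac)
    ultimately have "\<epsilon> r * sgn (w\<^sub>1 r) = sgn (deriv_in I u\<^sub>2 r)"
      by simp
    moreover have "\<bar>deriv_in I w r\<bar> = \<bar>y\<^sub>1\<bar>"
      using w_nz(1) by (simp add: dw abs_mult abs_sgn_eq)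
    ultimately have z_eq: "z r = - (sgn (deriv_in I u\<^sub>2 r) * r powr (1 + \<sigma>) * \<bar>w\<^sub>1 r\<bar> powr q
              * \<bar>y\<^sub>1\<bar> powr (- P) * y\<^sub>1)"
      unfolding assms(17) dw unfolding assms(8,11) by (simp add: mult_ac)
    note pde diff s_eq S_eq Z_eq log z_eq y\<^sub>1_def
  }
  note at_point = this
  have "P > 1" using \<open>p > 0\<close> by (simp add: assms(10))
  with at_point show ?thesis by metis
qed

end
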